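(* Fix $i\in[k]$ and fix the factor matrices $U^{(j)}\in\mathbb{R}^{m_j\times R}$ for all $j\neq i$ (in the alternating minimization procedure these are the last updated values: $U^{(j)}=U^{(j)}_{t+1}$ for $j<i$ and $U^{(j)}=U^{(j)}_t$ for $j>i$). Let $f^{(i)}_{t+1}(U^{(i)}):=f(U^{(1)},\ldots,U^{(i-1)},U^{(i)},U^{(i+1)},\ldots,U^{(k)})$ be regarded as a function of $U^{(i)}\in\mathbb{R}^{m_i\times R}$ only. Let $\mathbf{x}:=\mathrm{vec}((U^{(i)})^{\top})\in\mathbb{R}^{m_iR}$ and let $g^{(i)}(\mathbf{x}):=f^{(i)}_{t+1}(U^{(i)})$, where additive terms that do not depend on $U^{(i)}$ are omitted. Then $g^{(i)}$ is the quadratic function $$g^{(i)}(\mathbf{x})=\tfrac12\,\mathbf{x}^{\top}M^{(i)}\mathbf{x}-\mathrm{vec}\big((Q^{(i)})^{\top}\big)^{\top}\mathbf{x},$$ with $$M^{(i)}:=A^{(i)}+I_{m_i}\otimes C^{(i)}+\lambda_i L^{(i)}\otimes I_R\in\mathbb{R}^{m_iR\times m_iR},\qquad Q^{(i)}:=\big(\mathcal{P}_{\Omega^{(i)}}(\mathcal{T}_{(i)})\big)\,U^{(-i)}\in\mathbb{R}^{m_i\times R},$$ where $A^{(i)}=\sum_{s=1}^{m_i}(\mathbf{e}_s\mathbf{e}_s^{\top})\otimes A^{(i)}_s\in\mathbb{R}^{m_iR\times m_iR}$ has the $R\times R$ diagonal blocks $$A^{(i)}_s=\sum_{\ell\in\Omega^{(i)}_s}(U^{(-i)}_{\ell,:})^{\top}U^{(-i)}_{\ell,:},\qquad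 s\in[m_i],\qquad \Omega^{(i)}_s=\{\ell:(s,\ell)\in\Omega^{(i)}\},$$ and $C^{(i)}\in\mathbb{R}^{R\times R}$ is the diagonal matrix $$C^{(i)}=\sum_{\substack{j=1\\ j\neq i}}^{k}\lambda_j\,\mathrm{diag}\Big(\big(\|U^{(-i,-j)}_{:,\ell}\|_2^2\big)_{\ell=1,\ldots,R}\Big).$$
   Context: Let $k\ge 2$, let $m_1,\ldots,m_k,R$ be positive integers, and write $[m]=\{1,\ldots,m\}$. Let $\mathcal{T}\in\mathbb{R}^{m_1\times\cdots\times m_k}$ be a tensor, $\Omega\subset[m_1]\times\cdots\times[m_k]$ an index set, and $\mathcal{P}_\Omega$ the projection that keeps the entries indexed by $\Omega$ and sets all others to zero. Let $\lambda_1,\ldots,\lambda_k\ge 0$ and $\lambda_L\ge 0$. Objective: for $U^{(j)}\in\mathbb{R}^{m_j\times R}$, $j\in[k]$, $$f(U^{(1)},\ldots,U^{(k)})=\tfrac12\|\mathcal{P}_\Omega(\mathcal{T}-[\![U^{(1)},\ldots,U^{(k)}]\!])\|_{\mathrm F}^2+\sum_{j=1}^k\tfrac{\lambda_j}{2}\mathrm{tr}\big((U^{(j)})^{\top}L^{(j)}U^{(j)}\big)+\sum_{j=1}^k\tfrac{\lambda_j}{2}\|U^{(-j)}\|_{\mathrm F}^2 .$$ Here $[\![U^{(1)},\ldots,U^{(k)}]\!]=\sum_{r=1}^R U^{(1)}_{:,r}\circ\cdots\circ U^{(k)}_{:,r}$ ($\circ$ is the outer product), i.e. its $(\ell_1,\ldots,\ell_k)$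 entry is $\sum_{r}U^{(1)}_{\ell_1 r}\cdots U^{(k)}_{\ell_k r}$. The matrices $L^{(j)}=\lambda_L\mathcal{L}^{(j)}+I_{m_j}$ are shifted graph Laplacians, with $\mathcal{L}^{(j)}=\mathrm{diag}(W^{(j)}\mathbf{1})-W^{(j)}$ and $W^{(j)}\in\mathbb{R}^{m_j\times m_j}$ the (symmetric) weighted adjacency matrix of a given undirected graph on $[m_j]$; $\mathbf 1$ is the all-ones vector. Notation: $\otimes$ is the Kronecker product. The Khatri–Rao product $U\odot V$ of $U\in\mathbb{R}^{m\times R}$, $V\in\mathbb{R}^{n\times R}$ is the $mn\times R$ matrix with $r$-th column $U_{:,r}\otimes V_{:,r}$. $U^{(-i)}:=U^{(k)}\odot\cdots\odot U^{(i+1)}\odot U^{(i-1)}\odot\cdots\odot U^{(1)}$ is the Khatri–Rao product, in decreasing order of index, of all $U^{(n)}$ with $n\ne i$; $U^{(-i,-j)}$ is the analogous product of all $U^{(n)}$ with $n\neq i,j$ (an empty product, occurring only for $k=2$, is the $1\times R$ row of ones). $X_{:,\ell}$ and $X_{\ell,:}$ denote the $\ell$-th column and $\ell$-th row (as a row vector) of $X$; $\mathbf{e}_s\in\mathbb{R}^{m_i}$ is the $s$-th standard basis vector; $\mathrm{vec}$ is column-major vectorization; $I_m$ is the $m\times m$ identity matrix. The mode-$i$ matricization $\mathcal{T}_{(i)}$ is the $m_i\times\prod_{j\ne i}m_j$ matrix with $(\mathcal{T}_{(i)})_{\ell_i,r_i}=\mathcal{T}_{\ell_1,\ldots,\ell_k}$,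 where $r_i=1+\sum_{n\neq i}(\ell_n-1)\prod_{j<n,\,j\neq i}m_j$. $\Omega^{(i)}$ is the set of the pairs $(\ell_i,r_i)$ obtained from $(\ell_1,\ldots,\ell_k)\in\Omega$ in this way, and $\mathcal{P}_{\Omega^{(i)}}$ is the corresponding projection on $m_i\times\prod_{j\neq i}m_j$ matrices (entries outside $\Omega^{(i)}$ are set to zero). *)

theory Defs
  imports
    "HOL-Library.FuncSet"
    "HOL-Analysis.L2_Norm"
    "Jordan_Normal_Form.Matrix"
begin

text \<open>
  All indices start at 0: the modes are \<open>0, \<dots>, k - 1\<close>, and mode \<open>n\<close> has the coordinates
  \<open>0, \<dots>, m n - 1\<close>. An order-\<open>k\<close> tensor is a function on multi-indices \<open>l\<close>, with \<open>l n\<close> the coordinate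
  in mode \<open>n\<close>; only its values on \<open>multi_indices k m\<close> matter. Families such as the factor
  matrices are functions of the mode.
\<close>


subsection \<open>Matrices\<close>

definition matrix_sum :: "nat \<Rightarrow> nat \<Rightarrow> ('i \<Rightarrow> real mat) \<Rightarrow> 'i set \<Rightarrow> real mat" where
  "matrix_sum nr nc F I = mat nr nc (\<lambda>p. \<Sum>x\<in>I. F x $$ p)"

definition kronecker :: "real mat \<Rightarrow> real mat \<Rightarrow> real mat"  (infixl \<open>\<otimes>\<^sub>K\<close> 70) where
  "A \<otimes>\<^sub>K B = mat (dim_row A * dim_row B) (dim_col A * dim_col B)
     (\<lambda>(a, b). A $$ (a div dim_row B, b div dim_col B) * B $$ (a mod dim_row B, b mod dim_col B))"

definition kronecker_vec :: "real vec \<Rightarrow> real vec \<Rightarrow> real vec" where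
  "kronecker_vec v w =
     Matrix.vec (dim_vec v * dim_vec w) (\<lambda>a. v $ (a div dim_vec w) * w $ (a mod dim_vec w))"

definition khatri_rao :: "real mat \<Rightarrow> real mat \<Rightarrow> real mat"  (infixr \<open>\<odot>\<^sub>K\<close> 70) where
  "U \<odot>\<^sub>K V = mat (dim_row U * dim_row V) (dim_col U)
     (\<lambda>(a, r). kronecker_vec (col U r) (col V r) $ a)"

definition rank_one :: "real vec \<Rightarrow> real vec \<Rightarrow> real mat" where
  \<comment> \<open>\<open>v w\<^sup>T\<close> for column vectors \<open>v\<close> and \<open>w\<close>\<close>
  "rank_one v w = mat (dim_vec v) (dim_vec w) (\<lambda>(a, b). v $ a * w $ b)"

definition vectorize :: "real mat \<Rightarrow> real vec" where
  \<comment> \<open>column-major\<close>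
  "vectorize X =
     Matrix.vec (dim_row X * dim_col X) (\<lambda>p. X $$ (p mod dim_row X, p div dim_row X))"

definition mat_trace :: "real mat \<Rightarrow> real" where
  "mat_trace A = (\<Sum>a<dim_row A. A $$ (a, a))"

definition frobenius_norm :: "real mat \<Rightarrow> real" where
  "frobenius_norm X = L2_set (\<lambda>p. X $$ p) ({..<dim_row X} \<times> {..<dim_col X})"

definition euclidean_norm :: "real vec \<Rightarrow> real" where
  "euclidean_norm v = L2_set (\<lambda>a. v $ a) {..<dim_vec v}"

definition proj_mat :: "(nat \<times> nat) set \<Rightarrow> real mat \<Rightarrow> real mat" where
  "proj_mat S X = mat (dim_row X) (dim_col X) (\<lambda>p. if p \<in> S then X $$ p else 0)"


subsection \<open>Tensors\<close>

definition multi_indices :: "nat \<Rightarrow> (nat \<Rightarrow> nat) \<Rightarrow> (nat \<Rightarrow> nat) set" where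
  "multi_indices k m = PiE {..<k} (\<lambda>n. {..<m n})"

definition proj_tensor ::
    "(nat \<Rightarrow> nat) set \<Rightarrow> ((nat \<Rightarrow> nat) \<Rightarrow> real) \<Rightarrow> (nat \<Rightarrow> nat) \<Rightarrow> real" where
  "proj_tensor \<Omega> T = (\<lambda>l. if l \<in> \<Omega> then T l else 0)"

definition tensor_frobenius_norm ::
    "nat \<Rightarrow> (nat \<Rightarrow> nat) \<Rightarrow> ((nat \<Rightarrow> nat) \<Rightarrow> real) \<Rightarrow> real" where
  "tensor_frobenius_norm k m T = L2_set T (multi_indices k m)"

definition cp_tensor :: "nat \<Rightarrow> nat \<Rightarrow> (nat \<Rightarrow> real mat) \<Rightarrow> (nat \<Rightarrow> nat) \<Rightarrow> real" where
  "cp_tensor k R U = (\<lambda>l. \<Sum>r<R. \<Prod>n<k. U n $$ (l n, r))"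

definition unfold_col :: "nat \<Rightarrow> (nat \<Rightarrow> nat) \<Rightarrow> nat \<Rightarrow> (nat \<Rightarrow> nat) \<Rightarrow> nat" where
  "unfold_col k m i l = (\<Sum>n\<in>{..<k} - {i}. l n * (\<Prod>j\<in>{..<n} - {i}. m j))"

definition matricization ::
    "nat \<Rightarrow> (nat \<Rightarrow> nat) \<Rightarrow> nat \<Rightarrow> ((nat \<Rightarrow> nat) \<Rightarrow> real) \<Rightarrow> real mat" where
  \<comment> \<open>The description is proper: \<open>l \<mapsto> (l i, unfold_col k m i l)\<close> is a bijection from the
    multi-indices onto the positions of this matrix.\<close>
  "matricization k m i T = mat (m i) (\<Prod>j\<in>{..<k} - {i}. m j)
     (\<lambda>(a, b). T (THE l. l \<in> multi_indices k m \<and> l i = a \<and> unfold_col k m i l = b))"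

definition unfold_set ::
    "nat \<Rightarrow> (nat \<Rightarrow> nat) \<Rightarrow> nat \<Rightarrow> (nat \<Rightarrow> nat) set \<Rightarrow> (nat \<times> nat) set" where
  "unfold_set k m i \<Omega> = (\<lambda>l. (l i, unfold_col k m i l)) ` \<Omega>"

definition khatri_rao_except ::
    "nat \<Rightarrow> nat \<Rightarrow> nat set \<Rightarrow> (nat \<Rightarrow> real mat) \<Rightarrow> real mat" where
  \<comment> \<open>The product over the modes outside \<open>S\<close> in decreasing order. The \<open>1 \<times> R\<close> row of ones is
    the empty product; it is neutral for \<open>\<odot>\<^sub>K\<close>, so it does not affect nonempty products.\<close>
  "khatri_rao_except k R S U =
     foldr (\<lambda>n X. U n \<odot>\<^sub>K X) (rev (filter (\<lambda>n. n \<notin> S) [0..<k])) (mat 1 R (\<lambda>_. 1))"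


subsection \<open>Graph Laplacians\<close>

definition weighted_adjacency :: "nat \<Rightarrow> nat set set \<Rightarrow> real mat \<Rightarrow> bool" where
  \<comment> \<open>\<open>W\<close> is a weight matrix of the undirected graph with vertices \<open>0, \<dots>, n - 1\<close> and edge set \<open>E\<close>.
    Loops (edges \<open>{a}\<close>) and weights of any sign are allowed.\<close>
  "weighted_adjacency n E W \<longleftrightarrow>
     E \<subseteq> {{a, b} | a b. a < n \<and> b < n} \<and> W \<in> carrier_mat n n \<and> transpose_mat W = W \<and>
     (\<forall>a<n. \<forall>b<n. W $$ (a, b) \<noteq> 0 \<longrightarrow> {a, b} \<in> E)"

definition laplacian :: "real mat \<Rightarrow> real mat" where
  "laplacian W = mat_diag (dim_row W) (\<lambda>a. (W *\<^sub>v Matrix.vec (dim_col W) (\<lambda>_. 1)) $ a) - W"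

definition shifted_laplacian :: "real \<Rightarrow> real mat \<Rightarrow> real mat" where
  "shifted_laplacian lamL W = lamL \<cdot>\<^sub>m laplacian W + 1\<^sub>m (dim_row W)"


subsection \<open>The objective and its restriction to one factor\<close>

definition objective ::
    "nat \<Rightarrow> (nat \<Rightarrow> nat) \<Rightarrow> nat \<Rightarrow> ((nat \<Rightarrow> nat) \<Rightarrow> real) \<Rightarrow> (nat \<Rightarrow> nat) set \<Rightarrow>
     (nat \<Rightarrow> real) \<Rightarrow> (nat \<Rightarrow> real mat) \<Rightarrow> (nat \<Rightarrow> real mat) \<Rightarrow> real" where
  "objective k m R T \<Omega> lam L U =
     1/2 * (tensor_frobenius_norm k m (proj_tensor \<Omega> (\<lambda>l. T l - cp_tensor k R U l)))\<^sup>2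
     + (\<Sum>j<k. lam j / 2 * mat_trace (transpose_mat (U j) * L j * U j))
     + (\<Sum>j<k. lam j / 2 * (frobenius_norm (khatri_rao_except k R {j} U))\<^sup>2)"

definition A_block ::
    "nat \<Rightarrow> (nat \<Rightarrow> nat) \<Rightarrow> nat \<Rightarrow> (nat \<Rightarrow> nat) set \<Rightarrow> nat \<Rightarrow> (nat \<Rightarrow> real mat) \<Rightarrow> nat \<Rightarrow> real mat" where
  "A_block k m R \<Omega> i U s =
     matrix_sum R R
       (\<lambda>l. rank_one (row (khatri_rao_except k R {i} U) l) (row (khatri_rao_except k R {i} U) l))
       {l. (s, l) \<in> unfold_set k m i \<Omega>}"

definition A_mat ::
    "nat \<Rightarrow> (nat \<Rightarrow> nat) \<Rightarrow> nat \<Rightarrow> (nat \<Rightarrow> nat) set \<Rightarrow> nat \<Rightarrow> (nat \<Rightarrow> real mat) \<Rightarrow> real mat" where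
  "A_mat k m R \<Omega> i U =
     matrix_sum (m i * R) (m i * R)
       (\<lambda>s. rank_one (unit_vec (m i) s) (unit_vec (m i) s) \<otimes>\<^sub>K A_block k m R \<Omega> i U s) {..<m i}"

definition C_mat ::
    "nat \<Rightarrow> nat \<Rightarrow> (nat \<Rightarrow> real) \<Rightarrow> nat \<Rightarrow> (nat \<Rightarrow> real mat) \<Rightarrow> real mat" where
  "C_mat k R lam i U =
     matrix_sum R R
       (\<lambda>j. lam j \<cdot>\<^sub>m
          mat_diag R (\<lambda>r. (euclidean_norm (col (khatri_rao_except k R {i, j} U) r))\<^sup>2))
       ({..<k} - {i})"

definition M_mat ::
    "nat \<Rightarrow> (nat \<Rightarrow> nat) \<Rightarrow> nat \<Rightarrow> (nat \<Rightarrow> nat) set \<Rightarrow> (nat \<Rightarrow> real) \<Rightarrow> (nat \<Rightarrow> real mat) \<Rightarrow>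
     nat \<Rightarrow> (nat \<Rightarrow> real mat) \<Rightarrow> real mat" where
  "M_mat k m R \<Omega> lam L i U =
     A_mat k m R \<Omega> i U + 1\<^sub>m (m i) \<otimes>\<^sub>K C_mat k R lam i U + lam i \<cdot>\<^sub>m (L i \<otimes>\<^sub>K 1\<^sub>m R)"

definition Q_mat ::
    "nat \<Rightarrow> (nat \<Rightarrow> nat) \<Rightarrow> nat \<Rightarrow> ((nat \<Rightarrow> nat) \<Rightarrow> real) \<Rightarrow> (nat \<Rightarrow> nat) set \<Rightarrow> nat \<Rightarrow>
     (nat \<Rightarrow> real mat) \<Rightarrow> real mat" where
  "Q_mat k m R T \<Omega> i U =
     proj_mat (unfold_set k m i \<Omega>) (matricization k m i T) * khatri_rao_except k R {i} U"

end

theory Submission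
  imports Defs
begin

text \<open>
  As a function of the one factor \<open>X = U\<^sup>(\<^sup>i\<^sup>)\<close>, each of the three parts of the objective is a polynomial of
  degree at most two in the entries of \<open>X\<close>, and each produces one summand of \<open>M\<close>. Row-by-row
  stacking puts \<open>X\<^sub>s\<^sub>r\<close> at position \<open>s R + r\<close> of \<open>x\<close>, which is the index convention of
  the Kronecker product, so \<open>x\<^sup>T (A \<otimes> B) x\<close> is the sum of \<open>X\<^sub>s\<^sub>r A\<^sub>s\<^sub>t B\<^sub>r\<^sub>q X\<^sub>t\<^sub>q\<close> over
  \<open>s, t, r, q\<close> (\<open>kronecker_quadratic_form\<close>).

  Data term. The CP tensor has the mode-\<open>i\<close> matricization \<open>X V\<^sup>T\<close>, where \<open>V\<close> is the Khatri-Rao product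
  of the fixed factors (\<open>cp_tensor_update\<close>): the row numbering of \<open>V\<close> and the column numbering of
  the matricization are the same mixed-radix numeration. Expanding the square of the residual
  \<open>T\<^sub>l - (X V\<^sup>T)\<^sub>l\<close> and grouping the observed entries by their row \<open>s\<close> gives the block-diagonal matrix
  \<open>A\<close> from the squares of \<open>X V\<^sup>T\<close>, the linear form given by \<open>Q\<close> from the cross terms, and a constant
  (\<open>data_term_expand\<close>).

  Laplacian term. The summand of mode \<open>i\<close> is the quadratic form of \<open>L \<otimes> I\<close>
  (\<open>laplacian_quadratic_form\<close>); the summands of the other modes are constant.

  Khatri-Rao norms. The squared norm of a Kronecker product of columns is the product of the squared
  norms. For a mode \<open>j \<noteq> i\<close>, column \<open>r\<close> therefore contributes the squared norm of the \<open>r\<close>-th column of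
  \<open>X\<close> times a weight independent of \<open>X\<close>, and the sums of these weights over \<open>j\<close>, with the
  coefficients \<open>\<lambda>\<^sub>j\<close>, form the diagonal matrix \<open>C\<close>
  (\<open>C_mat_quadratic_form\<close>). The product that leaves out mode \<open>i\<close> does not contain \<open>X\<close>.
\<close>

section \<open>Pairs of indices as one index\<close>

lemma sum_block_index:
  fixes f :: "nat \<Rightarrow> 'a::comm_monoid_add"
  shows "(\<Sum>p<a * b. f p) = (\<Sum>s<a. \<Sum>r<b. f (s * b + r))"
proof -
  have "(\<Sum>r<b. f (s * b + r)) = sum f {s * b..<s * b + b}" for s
    using sum.shift_bounds_nat_ivl[of f 0 "s * b" b] by (simp add: lessThan_atLeast0 add.commute)
  then show ?thesis
    by (simp add: sum.nat_group)
qed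

lemma block_index_less:
  fixes s r a b :: nat
  assumes "s < a" "r < b"
  shows "s * b + r < a * b"
proof -
  have "s * b + r < Suc s * b"
    using assms by simp
  also have "\<dots> \<le> a * b"
    using assms by (intro mult_le_mono1) simp
  finally show ?thesis .
qed

lemma kronecker_block_index:
  assumes "s < dim_row A" "r < dim_row B" "t < dim_col A" "q < dim_col B"
  shows "(A \<otimes>\<^sub>K B) $$ (s * dim_row B + r, t * dim_col B + q) = A $$ (s, t) * B $$ (r, q)"
  using assms by (simp add: kronecker_def block_index_less)


section \<open>Khatri-Rao products\<close>

text \<open>
  The column number in the matricization, with a set of modes left out instead of a single one. In
  an induction on the number of modes each new mode is either left out or becomes the most
  significant digit, so \<open>S\<close> can stay arbitrary.
\<close>

definition mixed_radix :: "nat \<Rightarrow> (nat \<Rightarrow> nat) \<Rightarrow> nat set \<Rightarrow> (nat \<Rightarrow> nat) \<Rightarrow> nat" where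
  "mixed_radix k m S l = (\<Sum>n\<in>{..<k} - S. l n * (\<Prod>j\<in>{..<n} - S. m j))"

lemma unfold_col_mixed_radix: "unfold_col k m i l = mixed_radix k m {i} l"
  by (simp add: unfold_col_def mixed_radix_def)

lemma lessThan_Suc_Diff:
  "{..<Suc k} - S = (if k \<in> S then {..<k} - S else insert k ({..<k} - S))"
  by (auto simp: less_Suc_eq)

lemma mixed_radix_Suc:
  "mixed_radix (Suc k) m S l =
     (if k \<in> S then mixed_radix k m S l
      else l k * (\<Prod>j\<in>{..<k} - S. m j) + mixed_radix k m S l)"
  by (simp add: mixed_radix_def lessThan_Suc_Diff)

lemma mixed_radix_less:
  assumes "\<And>n. n < k \<Longrightarrow> n \<notin> S \<Longrightarrow> l n < m n"
  shows "mixed_radix k m S l < (\<Prod>n\<in>{..<k} - S. m n)"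
  using assms
proof (induction k)
  case 0
  then show ?case by (simp add: mixed_radix_def)
next
  case (Suc k)
  then show ?case
    by (simp add: mixed_radix_Suc lessThan_Suc_Diff block_index_less)
qed

lemma mixed_radix_inject:
  assumes "\<And>n. n < k \<Longrightarrow> n \<notin> S \<Longrightarrow> l n < m n"
    and "\<And>n. n < k \<Longrightarrow> n \<notin> S \<Longrightarrow> l' n < m n"
    and "mixed_radix k m S l = mixed_radix k m S l'"
    and "n < k" "n \<notin> S"
  shows "l n = l' n"
  using assms
proof (induction k)
  case 0
  then show ?case by simp
next
  case (Suc k)
  show ?case
  proof (cases "k \<in> S")
    case True
    with Suc.prems have "n < k" by (auto simp: less_Suc_eq)
    with True Suc show ?thesis by (simp add: mixed_radix_Suc)
  next
    case False
    define N where "N = (\<Prod>j\<in>{..<k} - S. m j)"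
    have less: "mixed_radix k m S l < N" "mixed_radix k m S l' < N"
      using Suc.prems unfolding N_def by (auto intro!: mixed_radix_less)
    have eq: "l k * N + mixed_radix k m S l = l' k * N + mixed_radix k m S l'"
      using Suc.prems(3) False by (simp add: mixed_radix_Suc N_def)
    have "l k = l' k"
      using arg_cong[OF eq, of "\<lambda>p. p div N"] less by simp
    moreover have "mixed_radix k m S l = mixed_radix k m S l'"
      using arg_cong[OF eq, of "\<lambda>p. p mod N"] less by simp
    ultimately show ?thesis
      using Suc by (cases "n = k") auto
  qed
qed

lemma khatri_rao_except_Suc:
  "khatri_rao_except (Suc k) R S U =
     (if k \<in> S then khatri_rao_except k R S U else U k \<odot>\<^sub>K khatri_rao_except k R S U)"
  by (simp add: khatri_rao_except_def)

lemma khatri_rao_except_cong: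
  assumes "\<And>n. n < k \<Longrightarrow> n \<notin> S \<Longrightarrow> U n = U' n"
  shows "khatri_rao_except k R S U = khatri_rao_except k R S U'"
  using assms by (induction k) (auto simp: khatri_rao_except_Suc, simp add: khatri_rao_except_def)

lemma khatri_rao_except_carrier:
  assumes "\<And>n. n < k \<Longrightarrow> n \<notin> S \<Longrightarrow> U n \<in> carrier_mat (m n) R"
  shows "khatri_rao_except k R S U \<in> carrier_mat (\<Prod>n\<in>{..<k} - S. m n) R"
  using assms
proof (induction k)
  case 0
  then show ?case by (simp add: khatri_rao_except_def)
next
  case (Suc k)
  then have V: "khatri_rao_except k R S U \<in> carrier_mat (\<Prod>n\<in>{..<k} - S. m n) R"
    by simp
  show ?case
  proof (cases "k \<in> S")
    case True
    with V show ?thesis by (simp add: khatri_rao_except_Suc lessThan_Suc_Diff)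
  next
    case False
    with Suc.prems have "U k \<in> carrier_mat (m k) R" by simp
    with V False show ?thesis
      by (simp add: khatri_rao_except_Suc lessThan_Suc_Diff khatri_rao_def)
  qed
qed

lemma khatri_rao_block_index:
  assumes "U \<in> carrier_mat a R" "V \<in> carrier_mat b R" "s < a" "p < b" "r < R"
  shows "(U \<odot>\<^sub>K V) $$ (s * b + p, r) = U $$ (s, r) * V $$ (p, r)"
  using assms by (simp add: khatri_rao_def kronecker_vec_def block_index_less)

text \<open>
  Rows of a Khatri-Rao product are numbered as the columns of a matricization; this is why its factors
  appear in decreasing order.
\<close>

lemma khatri_rao_except_entry:
  assumes "\<And>n. n < k \<Longrightarrow> n \<notin> S \<Longrightarrow> U n \<in> carrier_mat (m n) R"
    and "\<And>n. n < k \<Longrightarrow> n \<notin> S \<Longrightarrow> l n < m n"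
    and "r < R"
  shows "khatri_rao_except k R S U $$ (mixed_radix k m S l, r) =
    (\<Prod>n\<in>{..<k} - S. U n $$ (l n, r))"
  using assms
proof (induction k)
  case 0
  then show ?case by (simp add: khatri_rao_except_def mixed_radix_def)
next
  case (Suc k)
  have "khatri_rao_except k R S U \<in> carrier_mat (\<Prod>n\<in>{..<k} - S. m n) R"
    using Suc.prems by (intro khatri_rao_except_carrier) simp
  moreover have "mixed_radix k m S l < (\<Prod>n\<in>{..<k} - S. m n)"
    using Suc.prems by (intro mixed_radix_less) simp
  ultimately show ?case
    using Suc khatri_rao_block_index[OF Suc.prems(1)[of k]]
    by (simp add: khatri_rao_except_Suc mixed_radix_Suc lessThan_Suc_Diff)
qed

text \<open>
  Summing over the rows of a Kronecker product of columns is a double sum over the rows of the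
  factors, and the square of the entry splits, so the double sum factors.
\<close>

lemma khatri_rao_except_column_norm:
  assumes "\<And>n. n < k \<Longrightarrow> n \<notin> S \<Longrightarrow> U n \<in> carrier_mat (m n) R"
    and "r < R"
  shows "(\<Sum>a<(\<Prod>n\<in>{..<k} - S. m n). (khatri_rao_except k R S U $$ (a, r))\<^sup>2) =
    (\<Prod>n\<in>{..<k} - S. \<Sum>a<m n. (U n $$ (a, r))\<^sup>2)"
  using assms
proof (induction k)
  case 0
  then show ?case by (simp add: khatri_rao_except_def)
next
  case (Suc k)
  define V where "V = khatri_rao_except k R S U"
  define N where "N = (\<Prod>n\<in>{..<k} - S. m n)"
  have V: "V \<in> carrier_mat N R"
    unfolding V_def N_def using Suc.prems by (intro khatri_rao_except_carrier) simp
  have IH: "(\<Sum>a<N. (V $$ (a, r))\<^sup>2) = (\<Prod>n\<in>{..<k} - S. \<Sum>a<m n. (U n $$ (a, r))\<^sup>2)"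
    unfolding V_def N_def using Suc by simp
  show ?case
  proof (cases "k \<in> S")
    case True
    then show ?thesis
      using IH by (simp add: khatri_rao_except_Suc lessThan_Suc_Diff V_def N_def)
  next
    case False
    have "(\<Sum>a<m k * N. ((U k \<odot>\<^sub>K V) $$ (a, r))\<^sup>2) =
        (\<Sum>s<m k. \<Sum>p<N. (U k $$ (s, r) * V $$ (p, r))\<^sup>2)"
      unfolding sum_block_index
      using Suc.prems(2) False khatri_rao_block_index[OF Suc.prems(1)[of k] V]
      by simp
    also have "\<dots> = (\<Sum>s<m k. (U k $$ (s, r))\<^sup>2) * (\<Sum>p<N. (V $$ (p, r))\<^sup>2)"
      by (simp add: power_mult_distrib sum_product)
    finally show ?thesis
      using False IH by (simp add: khatri_rao_except_Suc lessThan_Suc_Diff V_def N_def)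
  qed
qed

lemma euclidean_norm_col_square:
  assumes "V \<in> carrier_mat N R" "r < R"
  shows "(euclidean_norm (col V r))\<^sup>2 = (\<Sum>a<N. (V $$ (a, r))\<^sup>2)"
  using assms by (simp add: euclidean_norm_def L2_set_def sum_nonneg)

lemma frobenius_norm_square:
  assumes "V \<in> carrier_mat N R"
  shows "(frobenius_norm V)\<^sup>2 = (\<Sum>r<R. \<Sum>a<N. (V $$ (a, r))\<^sup>2)"
proof -
  have "(frobenius_norm V)\<^sup>2 = (\<Sum>a<N. \<Sum>r<R. (V $$ (a, r))\<^sup>2)"
    using assms by (simp add: frobenius_norm_def L2_set_def sum_nonneg sum.cartesian_product)
  then show ?thesis
    by (simp only: sum.swap[of _ "{..<R}"])
qed

text \<open>
  Column norms being multiplicative, the one factor \<open>X\<close> in mode \<open>i\<close> separates from all the others: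
  this is where the diagonal matrix \<open>C\<close> comes from.
\<close>

lemma frobenius_norm_khatri_rao_update:
  assumes U: "\<And>n. n < k \<Longrightarrow> n \<noteq> i \<Longrightarrow> U n \<in> carrier_mat (m n) R"
    and X: "X \<in> carrier_mat (m i) R" and "i < k" "j \<noteq> i"
  shows "(frobenius_norm (khatri_rao_except k R {j} (U(i := X))))\<^sup>2 =
    (\<Sum>r<R. (\<Sum>s<m i. (X $$ (s, r))\<^sup>2) *
      (euclidean_norm (col (khatri_rao_except k R {i, j} U) r))\<^sup>2)"
proof -
  let ?U = "U(i := X)"
  have U': "?U n \<in> carrier_mat (m n) R" if "n < k" for n
    using U X that by simp
  have V: "khatri_rao_except k R {j} ?U \<in> carrier_mat (\<Prod>n\<in>{..<k} - {j}. m n) R"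
    by (intro khatri_rao_except_carrier U')
  have V': "khatri_rao_except k R {i, j} U \<in> carrier_mat (\<Prod>n\<in>{..<k} - {i, j}. m n) R"
    by (intro khatri_rao_except_carrier U) auto
  have "(\<Sum>a<(\<Prod>n\<in>{..<k} - {j}. m n). (khatri_rao_except k R {j} ?U $$ (a, r))\<^sup>2) =
      (\<Sum>s<m i. (X $$ (s, r))\<^sup>2) * (euclidean_norm (col (khatri_rao_except k R {i, j} U) r))\<^sup>2"
    if r: "r < R" for r
  proof -
    have "(\<Sum>a<(\<Prod>n\<in>{..<k} - {j}. m n). (khatri_rao_except k R {j} ?U $$ (a, r))\<^sup>2) =
        (\<Prod>n\<in>{..<k} - {j}. \<Sum>a<m n. (?U n $$ (a, r))\<^sup>2)"
      using r by (intro khatri_rao_except_column_norm U')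
    also have "\<dots> = (\<Prod>n\<in>insert i ({..<k} - {i, j}). \<Sum>a<m n. (?U n $$ (a, r))\<^sup>2)"
      using assms(3,4) by (intro prod.cong) auto
    also have "\<dots> =
        (\<Sum>s<m i. (X $$ (s, r))\<^sup>2) * (\<Prod>n\<in>{..<k} - {i, j}. \<Sum>a<m n. (?U n $$ (a, r))\<^sup>2)"
      by (subst prod.insert) auto
    also have "(\<Prod>n\<in>{..<k} - {i, j}. \<Sum>a<m n. (?U n $$ (a, r))\<^sup>2) =
        (\<Prod>n\<in>{..<k} - {i, j}. \<Sum>a<m n. (U n $$ (a, r))\<^sup>2)"
      by (intro prod.cong) auto
    also have "(\<Prod>n\<in>{..<k} - {i, j}. \<Sum>a<m n. (U n $$ (a, r))\<^sup>2) =
        (euclidean_norm (col (khatri_rao_except k R {i, j} U) r))\<^sup>2"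
      unfolding euclidean_norm_col_square[OF V' r]
      using r U by (intro khatri_rao_except_column_norm[symmetric]) auto
    finally show ?thesis .
  qed
  then show ?thesis
    by (simp add: frobenius_norm_square[OF V])
qed


section \<open>Matricization of the data term\<close>

lemma unfold_inj_on:
  assumes "i < k"
  shows "inj_on (\<lambda>l. (l i, unfold_col k m i l)) (multi_indices k m)"
proof (rule inj_onI)
  fix l l'
  assume l: "l \<in> multi_indices k m" and l': "l' \<in> multi_indices k m"
    and eq: "(l i, unfold_col k m i l) = (l' i, unfold_col k m i l')"
  have "l n = l' n" if "n < k" for n
  proof (cases "n = i")
    case False
    then show ?thesis
      using mixed_radix_inject[of k "{i}" l m l' n] l l' eq that
      by (auto simp: multi_indices_def unfold_col_mixed_radix PiE_mem)
  qed (use eq in simp)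
  then show "l = l'"
    using l l' by (intro PiE_ext[of l "{..<k}" "\<lambda>n. {..<m n}" l']) (auto simp: multi_indices_def)
qed

lemma unfold_col_less:
  assumes "l \<in> multi_indices k m"
  shows "unfold_col k m i l < (\<Prod>j\<in>{..<k} - {i}. m j)"
  unfolding unfold_col_mixed_radix
  using assms by (intro mixed_radix_less) (auto simp: multi_indices_def)

lemma matricization_entry:
  assumes "l \<in> multi_indices k m" "i < k"
  shows "matricization k m i T $$ (l i, unfold_col k m i l) = T l"
proof -
  have "(THE l'. l' \<in> multi_indices k m \<and> l' i = l i \<and> unfold_col k m i l' = unfold_col k m i l) = l"
    using assms inj_onD[OF unfold_inj_on[OF assms(2), of m]] by (intro the_equality) auto
  moreover have "l i < m i"
    using assms by (auto simp: multi_indices_def)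
  ultimately show ?thesis
    using unfold_col_less[OF assms(1), of i] by (simp add: matricization_def)
qed

lemma finite_multi_indices: "finite (multi_indices k m)"
  by (simp add: multi_indices_def finite_PiE)

text \<open>
  Injectivity of the unfolding lets the set of observed positions stand for the set of observed
  multi-indices. The left-hand side groups them by row, as the blocks of \<open>A\<close> and the rows of \<open>Q\<close> do.
\<close>

lemma sum_unfold_set:
  fixes h :: "nat \<Rightarrow> nat \<Rightarrow> 'a::comm_monoid_add"
  assumes \<Omega>: "\<Omega> \<subseteq> multi_indices k m" and "i < k"
  shows "(\<Sum>s<m i. \<Sum>b | (s, b) \<in> unfold_set k m i \<Omega>. h s b) =
    (\<Sum>l\<in>\<Omega>. h (l i) (unfold_col k m i l))"
proof -
  have fin: "finite (unfold_set k m i \<Omega>)"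
    unfolding unfold_set_def using \<Omega> finite_multi_indices finite_subset by blast
  have "finite {b. (s, b) \<in> unfold_set k m i \<Omega>}" for s
    by (rule finite_subset[OF _ finite_imageI[OF fin, of snd]]) force
  then have "(\<Sum>s<m i. \<Sum>b | (s, b) \<in> unfold_set k m i \<Omega>. h s b) =
      (\<Sum>(s, b)\<in>(SIGMA s:{..<m i}. {b. (s, b) \<in> unfold_set k m i \<Omega>}). h s b)"
    by (intro sum.Sigma) auto
  also have "(SIGMA s:{..<m i}. {b. (s, b) \<in> unfold_set k m i \<Omega>}) = unfold_set k m i \<Omega>"
    using \<Omega> \<open>i < k\<close> by (fastforce simp: unfold_set_def multi_indices_def PiE_iff)
  also have "(\<Sum>(s, b)\<in>unfold_set k m i \<Omega>. h s b) = (\<Sum>l\<in>\<Omega>. h (l i) (unfold_col k m i l))"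
    unfolding unfold_set_def
    using inj_on_subset[OF unfold_inj_on[OF \<open>i < k\<close>] \<Omega>] by (simp add: sum.reindex)
  finally show ?thesis .
qed

text \<open>
  In matrix terms, the unfolded CP tensor is \<open>X V\<^sup>T\<close> with \<open>V\<close> the Khatri-Rao product of the fixed
  factors: it is linear in \<open>X\<close>, so the data term is a least-squares problem.
\<close>

lemma cp_tensor_update:
  assumes U: "\<And>n. n < k \<Longrightarrow> n \<noteq> i \<Longrightarrow> U n \<in> carrier_mat (m n) R"
    and "i < k" and l: "l \<in> multi_indices k m"
  shows "cp_tensor k R (U(i := X)) l =
    (\<Sum>r<R. X $$ (l i, r) * khatri_rao_except k R {i} U $$ (unfold_col k m i l, r))"
  unfolding cp_tensor_def
proof (intro sum.cong refl)
  fix r assume "r \<in> {..<R}"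
  then have "khatri_rao_except k R {i} U $$ (unfold_col k m i l, r) =
      (\<Prod>n\<in>{..<k} - {i}. U n $$ (l n, r))"
    unfolding unfold_col_mixed_radix
    using U l by (intro khatri_rao_except_entry) (auto simp: multi_indices_def)
  moreover have "(\<Prod>n<k. (U(i := X)) n $$ (l n, r)) =
      X $$ (l i, r) * (\<Prod>n\<in>{..<k} - {i}. (U(i := X)) n $$ (l n, r))"
    using \<open>i < k\<close> by (subst prod.remove[of _ i]) auto
  moreover have "(\<Prod>n\<in>{..<k} - {i}. (U(i := X)) n $$ (l n, r)) =
      (\<Prod>n\<in>{..<k} - {i}. U n $$ (l n, r))"
    by (intro prod.cong) auto
  ultimately show "(\<Prod>n<k. (U(i := X)) n $$ (l n, r)) =
      X $$ (l i, r) * khatri_rao_except k R {i} U $$ (unfold_col k m i l, r)"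
    by simp
qed

lemma tensor_frobenius_norm_proj_square:
  assumes "\<Omega> \<subseteq> multi_indices k m"
  shows "(tensor_frobenius_norm k m (proj_tensor \<Omega> T))\<^sup>2 = (\<Sum>l\<in>\<Omega>. (T l)\<^sup>2)"
proof -
  have "(tensor_frobenius_norm k m (proj_tensor \<Omega> T))\<^sup>2 =
      (\<Sum>l\<in>multi_indices k m. (proj_tensor \<Omega> T l)\<^sup>2)"
    by (simp add: tensor_frobenius_norm_def L2_set_def sum_nonneg)
  also have "\<dots> = (\<Sum>l\<in>\<Omega>. (T l)\<^sup>2)"
    using assms finite_multi_indices
    by (intro sum.mono_neutral_cong_right) (auto simp: proj_tensor_def)
  finally show ?thesis .
qed


section \<open>Linear and quadratic forms in the vectorized factor\<close>

lemma vectorize_transpose_block_index: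
  assumes "X \<in> carrier_mat n R" "s < n" "r < R"
  shows "vectorize (transpose_mat X) $ (s * R + r) = X $$ (s, r)"
proof -
  have "s * R + r < R * n"
    using block_index_less[OF assms(2,3)] by (simp only: mult.commute)
  then show ?thesis
    using assms by (simp add: vectorize_def)
qed

lemma vectorize_transpose_carrier:
  assumes "X \<in> carrier_mat n R"
  shows "vectorize (transpose_mat X) \<in> carrier_vec (n * R)"
proof -
  have "dim_vec (vectorize (transpose_mat X)) = R * n"
    using assms by (simp add: vectorize_def)
  then show ?thesis
    by (simp only: carrier_vec_def mem_Collect_eq mult.commute)
qed

lemma scalar_prod_vectorize_transpose:
  assumes "Q \<in> carrier_mat n R" "X \<in> carrier_mat n R"
  shows "vectorize (transpose_mat Q) \<bullet> vectorize (transpose_mat X) =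
    (\<Sum>s<n. \<Sum>r<R. Q $$ (s, r) * X $$ (s, r))"
proof -
  have "dim_vec (vectorize (transpose_mat X)) = n * R"
    using vectorize_transpose_carrier[OF assms(2)] by simp
  then have "vectorize (transpose_mat Q) \<bullet> vectorize (transpose_mat X) =
      (\<Sum>p<n * R. vectorize (transpose_mat Q) $ p * vectorize (transpose_mat X) $ p)"
    by (simp add: scalar_prod_def lessThan_atLeast0)
  then show ?thesis
    using assms by (simp add: sum_block_index vectorize_transpose_block_index)
qed

lemma quadratic_form_vectorize_transpose:
  assumes X: "X \<in> carrier_mat n R" and M: "M \<in> carrier_mat (n * R) (n * R)"
    and x: "x = vectorize (transpose_mat X)"
  shows "x \<bullet> (M *\<^sub>v x) =
    (\<Sum>s<n. \<Sum>r<R. \<Sum>t<n. \<Sum>q<R. X $$ (s, r) * M $$ (s * R + r, t * R + q) * X $$ (t, q))"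
proof -
  have dim: "dim_vec x = n * R"
    using vectorize_transpose_carrier[OF X] x by simp
  have "x \<bullet> (M *\<^sub>v x) = (\<Sum>p<n * R. x $ p * (\<Sum>p'<n * R. M $$ (p, p') * x $ p'))"
    using M dim by (simp add: scalar_prod_def lessThan_atLeast0)
  also have "\<dots> = (\<Sum>s<n. \<Sum>r<R. x $ (s * R + r) *
      (\<Sum>t<n. \<Sum>q<R. M $$ (s * R + r, t * R + q) * x $ (t * R + q)))"
    by (simp add: sum_block_index)
  also have "\<dots> = (\<Sum>s<n. \<Sum>r<R. X $$ (s, r) *
      (\<Sum>t<n. \<Sum>q<R. M $$ (s * R + r, t * R + q) * X $$ (t, q)))"
    using X by (simp add: x vectorize_transpose_block_index)
  finally show ?thesis
    by (simp add: sum_distrib_left mult.assoc)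
qed

lemma kronecker_quadratic_form:
  assumes X: "X \<in> carrier_mat n R" and A: "A \<in> carrier_mat n n" and B: "B \<in> carrier_mat R R"
    and x: "x = vectorize (transpose_mat X)"
  shows "x \<bullet> ((A \<otimes>\<^sub>K B) *\<^sub>v x) =
    (\<Sum>s<n. \<Sum>r<R. \<Sum>t<n. \<Sum>q<R. X $$ (s, r) * (A $$ (s, t) * B $$ (r, q)) * X $$ (t, q))"
proof -
  have "A \<otimes>\<^sub>K B \<in> carrier_mat (n * R) (n * R)"
    using A B by (simp add: kronecker_def)
  then show ?thesis
    using A B kronecker_block_index[of _ A _ B]
    by (simp add: quadratic_form_vectorize_transpose[OF X _ x])
qed

lemma quadratic_form_add:
  fixes x :: "'a::comm_semiring_0 vec"
  assumes "A \<in> carrier_mat n n" "B \<in> carrier_mat n n" "x \<in> carrier_vec n"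
  shows "x \<bullet> ((A + B) *\<^sub>v x) = x \<bullet> (A *\<^sub>v x) + x \<bullet> (B *\<^sub>v x)"
proof -
  have "(A + B) *\<^sub>v x = A *\<^sub>v x + B *\<^sub>v x"
    using assms by (rule add_mult_distrib_mat_vec)
  then show ?thesis
    using assms scalar_prod_add_distrib[of x n "A *\<^sub>v x" "B *\<^sub>v x"] by simp
qed

lemma quadratic_form_smult:
  fixes x :: "'a::comm_ring vec"
  assumes "A \<in> carrier_mat n n" "x \<in> carrier_vec n"
  shows "x \<bullet> ((c \<cdot>\<^sub>m A) *\<^sub>v x) = c * (x \<bullet> (A *\<^sub>v x))"
proof -
  have "(c \<cdot>\<^sub>m A) *\<^sub>v x = c \<cdot>\<^sub>v (A *\<^sub>v x)"
    using assms by (intro eq_vecI) (auto simp: scalar_prod_def sum_distrib_left mult.assoc)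
  then show ?thesis
    using assms scalar_prod_smult_distrib[of x n "A *\<^sub>v x" c] by simp
qed

lemma mat_trace_quadratic:
  assumes X: "X \<in> carrier_mat n R" and L: "L \<in> carrier_mat n n"
  shows "mat_trace (transpose_mat X * L * X) =
    (\<Sum>r<R. \<Sum>s<n. \<Sum>t<n. X $$ (s, r) * L $$ (s, t) * X $$ (t, r))"
proof -
  have "transpose_mat X * L * X = transpose_mat X * (L * X)"
    using X L by (intro assoc_mult_mat[of _ R n _ n _ R]) auto
  then show ?thesis
    using X L by (simp add: mat_trace_def scalar_prod_def lessThan_atLeast0 sum_distrib_left mult.assoc)
qed

lemma laplacian_quadratic_form:
  assumes X: "X \<in> carrier_mat n R" and L: "L \<in> carrier_mat n n"
    and x: "x = vectorize (transpose_mat X)"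
  shows "x \<bullet> ((L \<otimes>\<^sub>K 1\<^sub>m R) *\<^sub>v x) = mat_trace (transpose_mat X * L * X)"
proof -
  have "x \<bullet> ((L \<otimes>\<^sub>K 1\<^sub>m R) *\<^sub>v x) = (\<Sum>s<n. \<Sum>r<R. \<Sum>t<n. \<Sum>q<R.
      X $$ (s, r) * (L $$ (s, t) * 1\<^sub>m R $$ (r, q)) * X $$ (t, q))"
    using X L x by (intro kronecker_quadratic_form) auto
  also have "\<dots> = (\<Sum>s<n. \<Sum>r<R. \<Sum>t<n. X $$ (s, r) * L $$ (s, t) * X $$ (t, r))"
  proof (intro sum.cong refl)
    fix s r t assume "r \<in> {..<R}"
    then have "(\<Sum>q<R. X $$ (s, r) * (L $$ (s, t) * 1\<^sub>m R $$ (r, q)) * X $$ (t, q)) =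
        (\<Sum>q<R. if q = r then X $$ (s, r) * L $$ (s, t) * X $$ (t, r) else 0)"
      by (intro sum.cong) auto
    then show "(\<Sum>q<R. X $$ (s, r) * (L $$ (s, t) * 1\<^sub>m R $$ (r, q)) * X $$ (t, q)) =
        X $$ (s, r) * L $$ (s, t) * X $$ (t, r)"
      using \<open>r \<in> {..<R}\<close> by simp
  qed
  also have "\<dots> = mat_trace (transpose_mat X * L * X)"
    unfolding mat_trace_quadratic[OF X L] by (rule sum.swap)
  finally show ?thesis .
qed

lemma diagonal_quadratic_form:
  assumes X: "X \<in> carrier_mat n R" and C: "C \<in> carrier_mat R R"
    and diag: "\<And>r q. r < R \<Longrightarrow> q < R \<Longrightarrow> r \<noteq> q \<Longrightarrow> C $$ (r, q) = 0"
    and x: "x = vectorize (transpose_mat X)"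
  shows "x \<bullet> ((1\<^sub>m n \<otimes>\<^sub>K C) *\<^sub>v x) = (\<Sum>r<R. C $$ (r, r) * (\<Sum>s<n. (X $$ (s, r))\<^sup>2))"
proof -
  have "x \<bullet> ((1\<^sub>m n \<otimes>\<^sub>K C) *\<^sub>v x) = (\<Sum>s<n. \<Sum>r<R. \<Sum>t<n. \<Sum>q<R.
      X $$ (s, r) * (1\<^sub>m n $$ (s, t) * C $$ (r, q)) * X $$ (t, q))"
    using X C x by (intro kronecker_quadratic_form) auto
  also have "\<dots> = (\<Sum>s<n. \<Sum>r<R. \<Sum>t<n. if t = s
      then \<Sum>q<R. if q = r then C $$ (r, r) * (X $$ (s, r))\<^sup>2 else 0 else 0)"
  proof (intro sum.cong refl)
    fix s r t assume *: "s \<in> {..<n}" "r \<in> {..<R}" "t \<in> {..<n}"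
    have "X $$ (s, r) * (1\<^sub>m n $$ (s, t) * C $$ (r, q)) * X $$ (t, q) =
        (if t = s then if q = r then C $$ (r, r) * (X $$ (s, r))\<^sup>2 else 0 else 0)"
      if "q < R" for q
      using * that diag[of r q] by (auto simp: power2_eq_square)
    then have "(\<Sum>q<R. X $$ (s, r) * (1\<^sub>m n $$ (s, t) * C $$ (r, q)) * X $$ (t, q)) =
        (\<Sum>q<R. if t = s then if q = r then C $$ (r, r) * (X $$ (s, r))\<^sup>2 else 0 else 0)"
      by (intro sum.cong refl) (simp only: lessThan_iff)
    then show "(\<Sum>q<R. X $$ (s, r) * (1\<^sub>m n $$ (s, t) * C $$ (r, q)) * X $$ (t, q)) =
        (if t = s then \<Sum>q<R. if q = r then C $$ (r, r) * (X $$ (s, r))\<^sup>2 else 0 else 0)"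
      by simp
  qed
  also have "\<dots> = (\<Sum>s<n. \<Sum>r<R. C $$ (r, r) * (X $$ (s, r))\<^sup>2)"
    by simp
  also have "\<dots> = (\<Sum>r<R. C $$ (r, r) * (\<Sum>s<n. (X $$ (s, r))\<^sup>2))"
    by (subst sum.swap) (simp add: sum_distrib_left)
  finally show ?thesis .
qed

lemma A_mat_block_index:
  assumes "s < m i" "t < m i" "r < R" "q < R"
  shows "A_mat k m R \<Omega> i U $$ (s * R + r, t * R + q) =
    (if s = t then A_block k m R \<Omega> i U s $$ (r, q) else 0)"
proof -
  have "A_mat k m R \<Omega> i U $$ (s * R + r, t * R + q) =
      (\<Sum>u<m i. (rank_one (unit_vec (m i) u) (unit_vec (m i) u) \<otimes>\<^sub>K A_block k m R \<Omega> i U u)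
        $$ (s * R + r, t * R + q))"
    using assms by (simp add: A_mat_def matrix_sum_def block_index_less)
  also have "\<dots> = (\<Sum>u<m i. if u = s then (if s = t then A_block k m R \<Omega> i U s $$ (r, q) else 0) else 0)"
  proof (intro sum.cong refl)
    fix u assume "u \<in> {..<m i}"
    then show "(rank_one (unit_vec (m i) u) (unit_vec (m i) u) \<otimes>\<^sub>K A_block k m R \<Omega> i U u)
        $$ (s * R + r, t * R + q) =
        (if u = s then (if s = t then A_block k m R \<Omega> i U s $$ (r, q) else 0) else 0)"
      using assms kronecker_block_index[of s "rank_one (unit_vec (m i) u) (unit_vec (m i) u)" r
          "A_block k m R \<Omega> i U u" t q]
      by (auto simp: rank_one_def A_block_def matrix_sum_def)
  qed
  finally show ?thesis
    using assms by simp
qed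

lemma A_block_entry:
  assumes "khatri_rao_except k R {i} U \<in> carrier_mat N R" "r < R" "q < R"
  shows "A_block k m R \<Omega> i U s $$ (r, q) = (\<Sum>b | (s, b) \<in> unfold_set k m i \<Omega>.
    khatri_rao_except k R {i} U $$ (b, r) * khatri_rao_except k R {i} U $$ (b, q))"
  using assms by (simp add: A_block_def matrix_sum_def rank_one_def row_def)

text \<open>
  Each block of \<open>A\<close> is a Gram matrix of rows of \<open>V\<close>, hence its quadratic form is a sum of squares of
  the observed entries of \<open>X V\<^sup>T\<close>.
\<close>

lemma A_mat_quadratic_form:
  assumes X: "X \<in> carrier_mat (m i) R" and \<Omega>: "\<Omega> \<subseteq> multi_indices k m" and "i < k"
    and V: "V = khatri_rao_except k R {i} U" "V \<in> carrier_mat N R"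
    and x: "x = vectorize (transpose_mat X)"
  shows "x \<bullet> (A_mat k m R \<Omega> i U *\<^sub>v x) =
    (\<Sum>l\<in>\<Omega>. (\<Sum>r<R. X $$ (l i, r) * V $$ (unfold_col k m i l, r))\<^sup>2)"
proof -
  have A: "A_mat k m R \<Omega> i U \<in> carrier_mat (m i * R) (m i * R)"
    by (simp add: A_mat_def matrix_sum_def)
  have "x \<bullet> (A_mat k m R \<Omega> i U *\<^sub>v x) = (\<Sum>s<m i. \<Sum>r<R. \<Sum>t<m i. \<Sum>q<R.
      X $$ (s, r) * A_mat k m R \<Omega> i U $$ (s * R + r, t * R + q) * X $$ (t, q))"
    by (rule quadratic_form_vectorize_transpose[OF X A x])
  also have "\<dots> = (\<Sum>s<m i. \<Sum>r<R. \<Sum>t<m i.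
      if t = s then \<Sum>q<R. X $$ (s, r) * A_block k m R \<Omega> i U s $$ (r, q) * X $$ (s, q) else 0)"
    by (intro sum.cong refl) (simp add: A_mat_block_index)
  also have "\<dots> = (\<Sum>s<m i. \<Sum>r<R. \<Sum>q<R. X $$ (s, r) * A_block k m R \<Omega> i U s $$ (r, q) * X $$ (s, q))"
    by simp
  also have "\<dots> = (\<Sum>s<m i. \<Sum>b | (s, b) \<in> unfold_set k m i \<Omega>. (\<Sum>r<R. X $$ (s, r) * V $$ (b, r))\<^sup>2)"
  proof (rule sum.cong[OF refl])
    fix s
    let ?B = "{b. (s, b) \<in> unfold_set k m i \<Omega>}"
    have "(\<Sum>r<R. \<Sum>q<R. X $$ (s, r) * A_block k m R \<Omega> i U s $$ (r, q) * X $$ (s, q)) =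
        (\<Sum>r<R. \<Sum>q<R. \<Sum>b\<in>?B. (X $$ (s, r) * V $$ (b, r)) * (X $$ (s, q) * V $$ (b, q)))"
      using V by (intro sum.cong refl)
        (simp add: A_block_entry sum_distrib_left sum_distrib_right mult_ac)
    also have "\<dots> = (\<Sum>r<R. \<Sum>b\<in>?B. \<Sum>q<R. (X $$ (s, r) * V $$ (b, r)) * (X $$ (s, q) * V $$ (b, q)))"
      by (intro sum.cong refl sum.swap)
    also have "\<dots> = (\<Sum>b\<in>?B. \<Sum>r<R. \<Sum>q<R. (X $$ (s, r) * V $$ (b, r)) * (X $$ (s, q) * V $$ (b, q)))"
      by (rule sum.swap)
    also have "\<dots> = (\<Sum>b\<in>?B. (\<Sum>r<R. X $$ (s, r) * V $$ (b, r))\<^sup>2)"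
      by (simp add: power2_eq_square sum_product)
    finally show "(\<Sum>r<R. \<Sum>q<R. X $$ (s, r) * A_block k m R \<Omega> i U s $$ (r, q) * X $$ (s, q)) =
        (\<Sum>b\<in>?B. (\<Sum>r<R. X $$ (s, r) * V $$ (b, r))\<^sup>2)" .
  qed
  also have "\<dots> = (\<Sum>l\<in>\<Omega>. (\<Sum>r<R. X $$ (l i, r) * V $$ (unfold_col k m i l, r))\<^sup>2)"
    by (rule sum_unfold_set[OF \<Omega> \<open>i < k\<close>])
  finally show ?thesis .
qed

text \<open>
  The projection restricts the inner product of \<open>T\<close> with \<open>X V\<^sup>T\<close> to the observed entries: these are
  the cross terms of the least-squares problem.
\<close>

lemma Q_mat_linear_form:
  assumes X: "X \<in> carrier_mat (m i) R" and \<Omega>: "\<Omega> \<subseteq> multi_indices k m" and "i < k"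
    and V: "V = khatri_rao_except k R {i} U" "V \<in> carrier_mat (\<Prod>n\<in>{..<k} - {i}. m n) R"
  shows "vectorize (transpose_mat (Q_mat k m R T \<Omega> i U)) \<bullet> vectorize (transpose_mat X) =
    (\<Sum>l\<in>\<Omega>. T l * (\<Sum>r<R. X $$ (l i, r) * V $$ (unfold_col k m i l, r)))"
proof -
  let ?N = "\<Prod>n\<in>{..<k} - {i}. m n"
  let ?S = "unfold_set k m i \<Omega>"
  let ?T = "matricization k m i T"
  have T: "?T \<in> carrier_mat (m i) ?N"
    by (simp add: matricization_def)
  have Q: "Q_mat k m R T \<Omega> i U \<in> carrier_mat (m i) R"
    using V T by (auto simp: Q_mat_def proj_mat_def)
  have S_less: "b < ?N" if "(s, b) \<in> ?S" for s b
    using that \<Omega> unfold_col_less[of _ k m i] by (auto simp: unfold_set_def)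
  have entry: "Q_mat k m R T \<Omega> i U $$ (s, r) = (\<Sum>b | (s, b) \<in> ?S. ?T $$ (s, b) * V $$ (b, r))"
    if "s < m i" "r < R" for s r
  proof -
    have "Q_mat k m R T \<Omega> i U $$ (s, r) =
        (\<Sum>b<?N. (if (s, b) \<in> ?S then ?T $$ (s, b) else 0) * V $$ (b, r))"
      using that V T by (auto simp: Q_mat_def proj_mat_def scalar_prod_def lessThan_atLeast0
          intro!: sum.cong)
    also have "\<dots> = (\<Sum>b | (s, b) \<in> ?S. ?T $$ (s, b) * V $$ (b, r))"
      using S_less by (intro sum.mono_neutral_cong_right) auto
    finally show ?thesis .
  qed
  have "vectorize (transpose_mat (Q_mat k m R T \<Omega> i U)) \<bullet> vectorize (transpose_mat X) =
      (\<Sum>s<m i. \<Sum>r<R. \<Sum>b | (s, b) \<in> ?S. ?T $$ (s, b) * V $$ (b, r) * X $$ (s, r))"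
    unfolding scalar_prod_vectorize_transpose[OF Q X] by (simp add: entry sum_distrib_right)
  also have "\<dots> = (\<Sum>s<m i. \<Sum>b | (s, b) \<in> ?S. \<Sum>r<R. ?T $$ (s, b) * V $$ (b, r) * X $$ (s, r))"
    by (intro sum.cong refl sum.swap)
  also have "\<dots> = (\<Sum>s<m i. \<Sum>b | (s, b) \<in> ?S. ?T $$ (s, b) * (\<Sum>r<R. X $$ (s, r) * V $$ (b, r)))"
    by (simp add: sum_distrib_left mult_ac)
  also have "\<dots> = (\<Sum>l\<in>\<Omega>. ?T $$ (l i, unfold_col k m i l) *
      (\<Sum>r<R. X $$ (l i, r) * V $$ (unfold_col k m i l, r)))"
    by (rule sum_unfold_set[OF \<Omega> \<open>i < k\<close>])
  also have "\<dots> = (\<Sum>l\<in>\<Omega>. T l * (\<Sum>r<R. X $$ (l i, r) * V $$ (unfold_col k m i l, r)))"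
    using \<Omega> by (intro sum.cong refl) (simp add: matricization_entry[OF subsetD[OF \<Omega>] \<open>i < k\<close>])
  finally show ?thesis .
qed

lemma data_term_expand:
  assumes U: "\<And>n. n < k \<Longrightarrow> n \<noteq> i \<Longrightarrow> U n \<in> carrier_mat (m n) R"
    and X: "X \<in> carrier_mat (m i) R" and \<Omega>: "\<Omega> \<subseteq> multi_indices k m" and "i < k"
    and x: "x = vectorize (transpose_mat X)"
  shows "1/2 * (tensor_frobenius_norm k m
        (proj_tensor \<Omega> (\<lambda>l. T l - cp_tensor k R (U(i := X)) l)))\<^sup>2 =
      1/2 * (x \<bullet> (A_mat k m R \<Omega> i U *\<^sub>v x))
      - vectorize (transpose_mat (Q_mat k m R T \<Omega> i U)) \<bullet> x + 1/2 * (\<Sum>l\<in>\<Omega>. (T l)\<^sup>2)"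
proof -
  define V where "V = khatri_rao_except k R {i} U"
  have V: "V \<in> carrier_mat (\<Prod>n\<in>{..<k} - {i}. m n) R"
    unfolding V_def using U by (intro khatri_rao_except_carrier) auto
  define y where "y = (\<lambda>l. \<Sum>r<R. X $$ (l i, r) * V $$ (unfold_col k m i l, r))"
  have "(tensor_frobenius_norm k m (proj_tensor \<Omega> (\<lambda>l. T l - cp_tensor k R (U(i := X)) l)))\<^sup>2 =
      (\<Sum>l\<in>\<Omega>. (T l - y l)\<^sup>2)"
    unfolding tensor_frobenius_norm_proj_square[OF \<Omega>] y_def V_def
    using U \<open>i < k\<close> \<Omega> by (intro sum.cong refl) (simp add: cp_tensor_update[of k i U m] subset_iff)
  also have "\<dots> = (\<Sum>l\<in>\<Omega>. (y l)\<^sup>2) - 2 * (\<Sum>l\<in>\<Omega>. T l * y l) + (\<Sum>l\<in>\<Omega>. (T l)\<^sup>2)"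
    by (simp add: power2_diff sum.distrib sum_subtractf sum_distrib_left mult_ac)
  finally show ?thesis
    using A_mat_quadratic_form[OF X \<Omega> \<open>i < k\<close> V_def V x]
      Q_mat_linear_form[OF X \<Omega> \<open>i < k\<close> V_def V, of T]
    by (simp add: y_def x)
qed

lemma C_mat_quadratic_form:
  assumes U: "\<And>n. n < k \<Longrightarrow> n \<noteq> i \<Longrightarrow> U n \<in> carrier_mat (m n) R"
    and X: "X \<in> carrier_mat (m i) R" and "i < k"
    and x: "x = vectorize (transpose_mat X)"
  shows "x \<bullet> ((1\<^sub>m (m i) \<otimes>\<^sub>K C_mat k R lam i U) *\<^sub>v x) =
    (\<Sum>j\<in>{..<k} - {i}. lam j * (frobenius_norm (khatri_rao_except k R {j} (U(i := X))))\<^sup>2)"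
proof -
  define w where "w = (\<lambda>j r. (euclidean_norm (col (khatri_rao_except k R {i, j} U) r))\<^sup>2)"
  have C: "C_mat k R lam i U \<in> carrier_mat R R"
    by (simp add: C_mat_def matrix_sum_def)
  have entry: "C_mat k R lam i U $$ (r, q) = (if r = q then \<Sum>j\<in>{..<k} - {i}. lam j * w j r else 0)"
    if "r < R" "q < R" for r q
    using that by (simp add: C_mat_def matrix_sum_def mat_diag_def w_def)
  have "x \<bullet> ((1\<^sub>m (m i) \<otimes>\<^sub>K C_mat k R lam i U) *\<^sub>v x) =
      (\<Sum>r<R. C_mat k R lam i U $$ (r, r) * (\<Sum>s<m i. (X $$ (s, r))\<^sup>2))"
    by (intro diagonal_quadratic_form X C x) (simp add: entry)
  also have "\<dots> = (\<Sum>r<R. \<Sum>j\<in>{..<k} - {i}. lam j * ((\<Sum>s<m i. (X $$ (s, r))\<^sup>2) * w j r))"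
    by (intro sum.cong refl) (simp add: entry sum_distrib_right mult_ac)
  also have "\<dots> = (\<Sum>j\<in>{..<k} - {i}. lam j * (\<Sum>r<R. (\<Sum>s<m i. (X $$ (s, r))\<^sup>2) * w j r))"
    by (subst sum.swap) (simp add: sum_distrib_left)
  also have "\<dots> =
      (\<Sum>j\<in>{..<k} - {i}. lam j * (frobenius_norm (khatri_rao_except k R {j} (U(i := X))))\<^sup>2)"
    using U X \<open>i < k\<close>
    by (intro sum.cong refl) (simp add: w_def frobenius_norm_khatri_rao_update[of k i U m])
  finally show ?thesis .
qed

lemma shifted_laplacian_carrier:
  assumes "W \<in> carrier_mat n n"
  shows "shifted_laplacian lamL W \<in> carrier_mat n n"
  using assms by (auto simp: shifted_laplacian_def laplacian_def mat_diag_def)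


section \<open>The restricted objective\<close>

theorem proposition3p1:
  fixes k R i :: nat
    and m :: "nat \<Rightarrow> nat"
    and T :: "(nat \<Rightarrow> nat) \<Rightarrow> real"
    and \<Omega> :: "(nat \<Rightarrow> nat) set"
    and lam :: "nat \<Rightarrow> real" and lamL :: real
    and E :: "nat \<Rightarrow> nat set set"
    and W L U :: "nat \<Rightarrow> real mat"
  assumes "k \<ge> 2" and "\<And>j. j < k \<Longrightarrow> m j > 0" and "R > 0"
    and "\<Omega> \<subseteq> multi_indices k m"
    and "\<And>j. j < k \<Longrightarrow> lam j \<ge> 0" and "lamL \<ge> 0"
    and "\<And>j. j < k \<Longrightarrow> weighted_adjacency (m j) (E j) (W j)"
    and "\<And>j. j < k \<Longrightarrow> L j = shifted_laplacian lamL (W j)"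
    and "i < k"
    and "\<And>j. j < k \<Longrightarrow> j \<noteq> i \<Longrightarrow> U j \<in> carrier_mat (m j) R"
  shows "M_mat k m R \<Omega> lam L i U \<in> carrier_mat (m i * R) (m i * R)
    \<and> Q_mat k m R T \<Omega> i U \<in> carrier_mat (m i) R
    \<and> (\<exists>c. \<forall>X \<in> carrier_mat (m i) R.
         objective k m R T \<Omega> lam L (U(i := X))
         = (let x = vectorize (transpose_mat X) in
             1/2 * (x \<bullet> (M_mat k m R \<Omega> lam L i U *\<^sub>v x))
             - vectorize (transpose_mat (Q_mat k m R T \<Omega> i U)) \<bullet> x) + c)"
proof (intro conjI)
  let ?M = "M_mat k m R \<Omega> lam L i U"
  let ?Q = "Q_mat k m R T \<Omega> i U"
  note U = assms(10)
  have A: "A_mat k m R \<Omega> i U \<in> carrier_mat (m i * R) (m i * R)"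
    by (simp add: A_mat_def matrix_sum_def)
  have C: "1\<^sub>m (m i) \<otimes>\<^sub>K C_mat k R lam i U \<in> carrier_mat (m i * R) (m i * R)"
    by (simp add: kronecker_def C_mat_def matrix_sum_def)
  have "W i \<in> carrier_mat (m i) (m i)"
    using assms(7)[OF \<open>i < k\<close>] by (simp add: weighted_adjacency_def)
  then have L: "L i \<in> carrier_mat (m i) (m i)"
    using assms(8)[OF \<open>i < k\<close>] by (simp add: shifted_laplacian_carrier)
  then have LI: "L i \<otimes>\<^sub>K 1\<^sub>m R \<in> carrier_mat (m i * R) (m i * R)"
    by (simp add: kronecker_def)
  show "?M \<in> carrier_mat (m i * R) (m i * R)"
    using A C LI by (simp add: M_mat_def)
  have "khatri_rao_except k R {i} U \<in> carrier_mat (\<Prod>n\<in>{..<k} - {i}. m n) R"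
    using U by (intro khatri_rao_except_carrier) auto
  then show "?Q \<in> carrier_mat (m i) R"
    by (auto simp: Q_mat_def proj_mat_def matricization_def)
  \<comment> \<open>The omitted terms: the observed data, the Laplacian terms of the fixed factors, and the norm of
    the Khatri-Rao product without mode \<open>i\<close>.\<close>
  define c where "c = 1/2 * (\<Sum>l\<in>\<Omega>. (T l)\<^sup>2)
    + (\<Sum>j\<in>{..<k} - {i}. lam j / 2 * mat_trace (transpose_mat (U j) * L j * U j))
    + lam i / 2 * (frobenius_norm (khatri_rao_except k R {i} U))\<^sup>2"
  show "\<exists>c. \<forall>X \<in> carrier_mat (m i) R.
         objective k m R T \<Omega> lam L (U(i := X))
         = (let x = vectorize (transpose_mat X) in
             1/2 * (x \<bullet> (?M *\<^sub>v x)) - vectorize (transpose_mat ?Q) \<bullet> x) + c"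
  proof (intro exI[of _ c] ballI)
    fix X :: "real mat"
    assume X: "X \<in> carrier_mat (m i) R"
    define x where "x = vectorize (transpose_mat X)"
    have xc: "x \<in> carrier_vec (m i * R)"
      unfolding x_def by (rule vectorize_transpose_carrier[OF X])
    let ?U = "U(i := X)"
    have "x \<bullet> (?M *\<^sub>v x) = x \<bullet> (A_mat k m R \<Omega> i U *\<^sub>v x)
        + x \<bullet> ((1\<^sub>m (m i) \<otimes>\<^sub>K C_mat k R lam i U) *\<^sub>v x)
        + x \<bullet> ((lam i \<cdot>\<^sub>m (L i \<otimes>\<^sub>K 1\<^sub>m R)) *\<^sub>v x)"
      unfolding M_mat_def using A C LI xc by (simp add: quadratic_form_add)
    also have "x \<bullet> ((lam i \<cdot>\<^sub>m (L i \<otimes>\<^sub>K 1\<^sub>m R)) *\<^sub>v x) =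
        lam i * mat_trace (transpose_mat X * L i * X)"
      by (simp add: quadratic_form_smult[OF LI xc] laplacian_quadratic_form[OF X L x_def])
    finally have M: "x \<bullet> (?M *\<^sub>v x) = x \<bullet> (A_mat k m R \<Omega> i U *\<^sub>v x)
        + (\<Sum>j\<in>{..<k} - {i}. lam j * (frobenius_norm (khatri_rao_except k R {j} ?U))\<^sup>2)
        + lam i * mat_trace (transpose_mat X * L i * X)"
      using C_mat_quadratic_form[of k i U m, OF U X \<open>i < k\<close> x_def] by simp
    have trace: "(\<Sum>j<k. lam j / 2 * mat_trace (transpose_mat (?U j) * L j * ?U j)) =
        lam i / 2 * mat_trace (transpose_mat X * L i * X)
        + (\<Sum>j\<in>{..<k} - {i}. lam j / 2 * mat_trace (transpose_mat (U j) * L j * U j))"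
      using \<open>i < k\<close> by (subst sum.remove[of _ i]) (auto intro!: sum.cong)
    have "khatri_rao_except k R {i} ?U = khatri_rao_except k R {i} U"
      by (rule khatri_rao_except_cong) auto
    then have norms: "(\<Sum>j<k. lam j / 2 * (frobenius_norm (khatri_rao_except k R {j} ?U))\<^sup>2) =
        lam i / 2 * (frobenius_norm (khatri_rao_except k R {i} U))\<^sup>2 +
        1/2 * (\<Sum>j\<in>{..<k} - {i}. lam j * (frobenius_norm (khatri_rao_except k R {j} ?U))\<^sup>2)"
      using \<open>i < k\<close> by (subst sum.remove[of _ i]) (auto simp: sum_distrib_left)
    show "objective k m R T \<Omega> lam L ?U = (let x = vectorize (transpose_mat X) in
        1/2 * (x \<bullet> (?M *\<^sub>v x)) - vectorize (transpose_mat ?Q) \<bullet> x) + c"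
      using data_term_expand[of k i U m, OF U X assms(4) \<open>i < k\<close> x_def, of T]
      unfolding objective_def trace norms Let_def x_def[symmetric] M c_def
      by (simp add: algebra_simps)
  qed
qed

end
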